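(* Let $d\in\mathbb{N}$, let $A$ be a real symmetric positive definite $d\times d$ matrix, let $h:\mathbb{R}^d\to\mathbb{R}^d$ be locally Lipschitz continuous and bounded, and let $p:\mathbb{R}\to\mathbb{R}^d$ be continuous and $2\pi$-periodic. Assume that there exists $n\in\mathbb{N}$ such that $n^2$ is an eigenvalue of $A$. Suppose moreover that there exists a nontrivial $2\pi$-periodic solution $v:\mathbb{R}\to\mathbb{R}^d$ of the linear system $v''+Av=0$ satisfying $$\sup_{\mathbb{R}^d}|h|\int_0^{2\pi}|v(t)|\,dt<\left|\int_0^{2\pi}\langle p(t),v(t)\rangle\,dt\right|.$$ Then, for every solution $x:\mathbb{R}\to\mathbb{R}^d$ of $$x''+Ax+h(x)=p(t),$$ it holds that $$\lim_{|t|\to+\infty}\left(|x(t)|^2+|x'(t)|^2\right)=+\infty.$$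
   Context: $\mathbb{N}=\{1,2,3,\dots\}$; $\langle\cdot,\cdot\rangle$ is the Euclidean scalar product in $\mathbb{R}^d$ and $|\cdot|$ the associated norm (or the absolute value of a real number). Since $h$ is locally Lipschitz and bounded and $p$ is continuous, every solution of the system is defined on all of $\mathbb{R}$. *)

theory Defs
  imports "HOL-Analysis.Analysis"
begin

definition pos_def_matrix :: "real ^ 'n ^ 'n \<Rightarrow> bool" where
  "pos_def_matrix A \<longleftrightarrow> (\<forall>u. u \<noteq> 0 \<longrightarrow> 0 < u \<bullet> (A *v u))"

definition matrix_eigenvalue :: "real ^ 'n ^ 'n \<Rightarrow> real \<Rightarrow> bool" where
  "matrix_eigenvalue A \<mu> \<longleftrightarrow> (\<exists>u. u \<noteq> 0 \<and> A *v u = \<mu> *\<^sub>R u)"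

(* The library's local_lipschitz concerns families indexed by a parameter;
   here the family is constant in its (real) parameter. *)
definition locally_lipschitz :: "('a::metric_space \<Rightarrow> 'b::metric_space) \<Rightarrow> bool" where
  "locally_lipschitz h \<longleftrightarrow> local_lipschitz (UNIV :: real set) UNIV (\<lambda>_. h)"

end

theory Submission
  imports Defs "HOL-Library.Periodic_Fun"
begin

text \<open>
  The proof measures how much the solution \<open>x\<close> resonates with the free oscillation \<open>v\<close>.
  The Wronskian-like quantity \<open>W = x' \<bullet> v - x \<bullet> v'\<close> satisfies \<open>W' = (p - h(x)) \<bullet> v\<close>: since \<open>A\<close>
  is symmetric, the two linear terms cancel (lemma \<open>wronskian_derivative\<close>). Hence, if \<open>s\<close> is the
  sign of the integral of \<open>p \<bullet> v\<close> over a period and \<open>H\<close> is the supremum of \<open>|h|\<close>, then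
  \<open>s W' \<ge> q\<close> with \<open>q = s (p \<bullet> v) - H |v|\<close>. The hypothesis on the forcing says exactly that
  the periodic function \<open>q\<close> has positive mean.

  An antiderivative of \<open>q\<close> is therefore a line of positive slope up to a bounded error (lemma
  \<open>antiderivative_of_periodic\<close>), so that \<open>s W\<close> grows at least linearly to the right and decays at
  least linearly to the left. In both directions \<open>|W(t)| \<ge> c |t| - b\<close> for some \<open>c > 0\<close>. But \<open>v\<close> and
  \<open>v'\<close> are bounded, so \<open>|W|\<close> is bounded by a constant times \<open>|x| + |x'|\<close>, and the latter must
  tend to infinity.
\<close>

lemma bounded_range_periodic:
  fixes f :: "real \<Rightarrow> 'a::metric_space"
  assumes cont: "continuous_on UNIV f" and per: "\<And>t. f (t + T) = f t" and T: "T > 0"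
  shows "bounded (range f)"
proof -
  interpret periodic_fun_simple f T
    by standard (rule per)
  have "f t \<in> f ` {0..T}" for t
  proof -
    have "t - of_int \<lfloor>t / T\<rfloor> * T = frac (t / T) * T"
      using T by (simp add: frac_def field_simps)
    moreover have "0 \<le> frac (t / T) * T" "frac (t / T) * T \<le> T"
      using T frac_lt_1[of "t / T"] frac_ge_0[of "t / T"] by (simp_all add: mult_le_cancel_right1)
    ultimately have "t - of_int \<lfloor>t / T\<rfloor> * T \<in> {0..T}" by simp
    then show ?thesis
      using minus_of_int[of t "\<lfloor>t / T\<rfloor>"] by (metis imageI)
  qed
  then have "range f \<subseteq> f ` {0..T}" by blast
  moreover have "bounded (f ` {0..T})"
    by (intro compact_imp_bounded compact_continuous_image continuous_on_subset[OF cont]) auto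
  ultimately show ?thesis by (rule bounded_subset[rotated])
qed

lemma has_vector_derivative_shift:
  fixes f :: "real \<Rightarrow> 'a::real_normed_vector"
  assumes "(f has_vector_derivative D) (at (t + T))"
  shows "((\<lambda>s. f (s + T)) has_vector_derivative D) (at t)"
proof -
  have "((\<lambda>s. s + T) has_vector_derivative 1) (at t)"
    using has_vector_derivative_add[OF has_vector_derivative_id has_vector_derivative_const] by simp
  then have "((f \<circ> (\<lambda>s. s + T)) has_vector_derivative (1 *\<^sub>R D)) (at t)"
    using assms by (rule vector_diff_chain_at)
  then show ?thesis by (simp add: o_def)
qed

lemma vector_derivative_of_periodic:
  fixes f f' :: "real \<Rightarrow> 'a::real_normed_vector"
  assumes deriv: "\<And>t. (f has_vector_derivative f' t) (at t)" and per: "\<And>t. f (t + T) = f t"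
  shows "f' (t + T) = f' t"
proof (rule vector_derivative_unique_at[OF _ deriv])
  show "(f has_vector_derivative f' (t + T)) (at t)"
    using has_vector_derivative_shift[OF deriv[of "t + T"]] by (simp add: per)
qed

text \<open>
  The increment of an antiderivative over one period has derivative zero, so it is constant.
  Subtracting the line whose slope is the mean leaves a continuous periodic function, and this
  is bounded.
\<close>

lemma antiderivative_of_periodic:
  fixes q Q :: "real \<Rightarrow> real"
  assumes deriv: "\<And>t. (Q has_vector_derivative q t) (at t)" and per: "\<And>t. q (t + T) = q t"
    and T: "T > 0"
  obtains B where "\<And>t. \<bar>Q t - integral {0..T} q / T * t\<bar> \<le> B"
proof -
  define R where "R t = Q t - integral {0..T} q / T * t" for t
  have "(q has_integral (Q T - Q 0)) {0..T}"
    using T by (intro fundamental_theorem_of_calculus has_vector_derivative_at_within[OF deriv]) auto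
  then have int: "integral {0..T} q = Q T - Q 0" by (rule integral_unique)
  have increment: "((\<lambda>s. Q (s + T) - Q s) has_vector_derivative 0) (at t)" for t
    using has_vector_derivative_diff
        [OF has_vector_derivative_shift[OF deriv[of "t + T"]] deriv[of t]] by (simp add: per)
  obtain k where k: "\<And>t. Q (t + T) - Q t = k"
    by (rule has_vector_derivative_zero_constant[OF convex_UNIV increment]) auto
  have "Q (t + T) = Q t + integral {0..T} q" for t
    using k[of 0] k[of t] int by simp
  then have "R (t + T) = R t" for t
    using T by (simp add: R_def distrib_left)
  moreover have "continuous_on UNIV Q"
    by (auto intro!: continuous_at_imp_continuous_on has_vector_derivative_continuous deriv)
  then have "continuous_on UNIV R"
    unfolding R_def by (intro continuous_intros)
  ultimately have "bounded (range R)"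
    using T by (intro bounded_range_periodic)
  then show ?thesis
    using that unfolding R_def bounded_iff by auto
qed

text \<open>
  Symmetry of \<open>A\<close> is what removes \<open>A\<close> from the derivative: \<open>-A x \<bullet> v\<close> from \<open>x'' \<bullet> v\<close> cancels
  \<open>x \<bullet> A v\<close> from \<open>-x \<bullet> v''\<close>.
\<close>

lemma wronskian_derivative:
  fixes A :: "real ^ 'd ^ 'd" and x x' v v' :: "real \<Rightarrow> real ^ 'd"
  assumes sym: "transpose A = A"
    and "(x has_vector_derivative x' t) (at t)" "(x' has_vector_derivative f - A *v x t) (at t)"
    and "(v has_vector_derivative v' t) (at t)" "(v' has_vector_derivative - (A *v v t)) (at t)"
  shows "((\<lambda>t. x' t \<bullet> v t - x t \<bullet> v' t) has_vector_derivative f \<bullet> v t) (at t)"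
proof -
  have "x t \<bullet> (A *v v t) = (A *v x t) \<bullet> v t"
    by (metis dot_lmul_matrix transpose_matrix_vector sym)
  then show ?thesis
    using has_vector_derivative_diff
        [OF bounded_bilinear.has_vector_derivative[OF bounded_bilinear_inner assms(3,4)]
          bounded_bilinear.has_vector_derivative[OF bounded_bilinear_inner assms(2,5)]]
    by (simp add: inner_diff_left)
qed

text \<open>
  A comparison principle for \<open>W' \<ge> q\<close>: the difference of \<open>W\<close> and an antiderivative of \<open>q\<close> is
  nondecreasing. It bounds \<open>W\<close> from below on the right of \<open>0\<close> and from above on the left, so a
  positive mean of \<open>q\<close> controls \<open>|W|\<close> from below on both sides.
\<close>

lemma abs_ge_linear_if_deriv_ge_periodic:
  fixes W w q :: "real \<Rightarrow> real"
  assumes deriv: "\<And>t. (W has_vector_derivative w t) (at t)" and ge: "\<And>t. q t \<le> w t"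
    and cont: "continuous_on UNIV q" and per: "\<And>t. q (t + T) = q t" and T: "T > 0"
  obtains b where "\<And>t. integral {0..T} q / T * \<bar>t\<bar> - b \<le> \<bar>W t\<bar>"
proof -
  have "\<exists>Q. \<forall>t. - \<infinity> < ereal t \<longrightarrow> ereal t < \<infinity> \<longrightarrow> (Q has_vector_derivative q t) (at t)"
    using cont by (intro einterval_antiderivative) (auto simp: continuous_on_eq_continuous_at)
  then obtain Q where Q: "\<And>t. (Q has_vector_derivative q t) (at t)" by auto
  define c where "c = integral {0..T} q / T"
  obtain B where B: "\<And>t. \<bar>Q t - c * t\<bar> \<le> B"
    using antiderivative_of_periodic[OF Q per T] unfolding c_def by blast
  have D: "((\<lambda>t. W t - Q t) has_real_derivative w t - q t) (at t)" for t
    using has_vector_derivative_diff[OF deriv Q]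
    by (simp add: has_real_derivative_iff_has_vector_derivative)
  have mono: "W s - Q s \<le> W t - Q t" if "s \<le> t" for s t
    by (rule DERIV_nonneg_imp_nondecreasing[OF that], rule exI, rule conjI[OF D]) (simp add: ge)
  have "c * \<bar>t\<bar> - (B + \<bar>W 0 - Q 0\<bar>) \<le> \<bar>W t\<bar>" for t
    using mono[of 0 t] mono[of t 0] B[of t] by (cases "t \<ge> 0") (auto simp: abs_if split: if_splits)
  then show ?thesis using that unfolding c_def by blast
qed

theorem theorem2p3:
  fixes A :: "real ^ 'd ^ 'd"
    and h :: "real ^ 'd \<Rightarrow> real ^ 'd"
    and p v v' v'' x x' x'' :: "real \<Rightarrow> real ^ 'd"
  assumes A_sym: "transpose A = A"
    and A_pos_def: "pos_def_matrix A"
    and h_lipschitz: "locally_lipschitz h"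
    and h_bounded: "bounded (range h)"
    and p_continuous: "continuous_on UNIV p"
    and p_periodic: "\<forall>t. p (t + 2 * pi) = p t"
    and resonance: "\<exists>n::nat. n \<ge> 1 \<and> matrix_eigenvalue A ((real n)\<^sup>2)"
    and v_deriv: "\<forall>t. (v has_vector_derivative v' t) (at t)"
    and v'_deriv: "\<forall>t. (v' has_vector_derivative v'' t) (at t)"
    and v_eq: "\<forall>t. v'' t + A *v v t = 0"
    and v_periodic: "\<forall>t. v (t + 2 * pi) = v t"
    and v_nontrivial: "\<exists>t. v t \<noteq> 0"
    and sup_h_bound: "(SUP y. norm (h y)) * integral {0..2 * pi} (\<lambda>t. norm (v t))
                          < \<bar>integral {0..2 * pi} (\<lambda>t. p t \<bullet> v t)\<bar>"
    and x_deriv: "\<forall>t. (x has_vector_derivative x' t) (at t)"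
    and x'_deriv: "\<forall>t. (x' has_vector_derivative x'' t) (at t)"
    and x_eq: "\<forall>t. x'' t + A *v x t + h (x t) = p t"
  shows "filterlim (\<lambda>t. (norm (x t))\<^sup>2 + (norm (x' t))\<^sup>2) at_top at_infinity"
proof -
  define H where "H = (SUP y. norm (h y))"
  define s where "s = sgn (integral {0..2 * pi} (\<lambda>t. p t \<bullet> v t))"
  define q where "q t = s * (p t \<bullet> v t) - H * norm (v t)" for t
  define W where "W t = x' t \<bullet> v t - x t \<bullet> v' t" for t
  have cont_v: "continuous_on UNIV v" and cont_v': "continuous_on UNIV v'"
    using v_deriv v'_deriv
    by (auto intro!: continuous_at_imp_continuous_on has_vector_derivative_continuous)
  have cont_q: "continuous_on UNIV q"
    unfolding q_def by (intro continuous_intros cont_v p_continuous)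
  have H: "norm (h y) \<le> H" for y
    unfolding H_def using h_bounded
    by (intro cSUP_upper) (auto simp: bounded_iff bdd_above_def)

  have mean_pos: "integral {0..2 * pi} q > 0"
  proof -
    have "(\<lambda>t. p t \<bullet> v t) integrable_on {0..2 * pi}" "(\<lambda>t. norm (v t)) integrable_on {0..2 * pi}"
      by (intro integrable_continuous_real continuous_intros
          continuous_on_subset[OF cont_v] continuous_on_subset[OF p_continuous]; simp)+
    then have "integral {0..2 * pi} q = s * integral {0..2 * pi} (\<lambda>t. p t \<bullet> v t)
        - H * integral {0..2 * pi} (\<lambda>t. norm (v t))"
      unfolding q_def by (subst integral_diff) (auto intro: integrable_on_mult_right)
    also have "s * integral {0..2 * pi} (\<lambda>t. p t \<bullet> v t) = \<bar>integral {0..2 * pi} (\<lambda>t. p t \<bullet> v t)\<bar>"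
      unfolding s_def by (simp add: abs_sgn mult.commute)
    finally show ?thesis using sup_h_bound by (simp add: H_def)
  qed

  have sW_deriv: "((\<lambda>t. s * W t) has_vector_derivative s * ((p t - h (x t)) \<bullet> v t)) (at t)" for t
  proof -
    have "x'' t = (p t - h (x t)) - A *v x t" "v'' t = - (A *v v t)"
      using x_eq[rule_format, of t] v_eq[rule_format, of t]
      by (simp_all add: algebra_simps eq_neg_iff_add_eq_0)
    then have "(W has_vector_derivative (p t - h (x t)) \<bullet> v t) (at t)"
      unfolding W_def using x_deriv x'_deriv[rule_format, of t] v_deriv v'_deriv[rule_format, of t]
      by (intro wronskian_derivative[OF A_sym]) auto
    then show ?thesis by (rule has_vector_derivative_mult_right)
  qed
  have q_le: "q t \<le> s * ((p t - h (x t)) \<bullet> v t)" for t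
  proof -
    have "\<bar>s\<bar> \<le> 1" by (simp add: s_def abs_sgn_eq)
    then have "\<bar>s * (h (x t) \<bullet> v t)\<bar> \<le> 1 * (H * norm (v t))"
      unfolding abs_mult
      by (intro mult_mono order_trans[OF Cauchy_Schwarz_ineq2] mult_right_mono H) auto
    then show ?thesis by (simp add: q_def inner_diff_left right_diff_distrib)
  qed
  have q_periodic: "q (t + 2 * pi) = q t" for t
    by (simp add: q_def p_periodic v_periodic)
  obtain b where b: "\<And>t. integral {0..2 * pi} q / (2 * pi) * \<bar>t\<bar> - b \<le> \<bar>s * W t\<bar>"
    by (rule abs_ge_linear_if_deriv_ge_periodic[OF sW_deriv q_le cont_q q_periodic]) auto

  define c where "c = integral {0..2 * pi} q / (2 * pi)"
  have "c > 0" using mean_pos by (simp add: c_def)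
  have W_lower: "c * \<bar>t\<bar> - b \<le> \<bar>W t\<bar>" for t
  proof -
    have "\<bar>s * W t\<bar> \<le> 1 * \<bar>W t\<bar>"
      unfolding abs_mult by (intro mult_right_mono) (auto simp: s_def abs_sgn_eq)
    then show ?thesis using b[of t] by (simp add: c_def)
  qed

  have "bounded (range v)" "bounded (range v')"
    using v_periodic vector_derivative_of_periodic[of v v' "2 * pi"] v_deriv cont_v cont_v'
    by (auto intro!: bounded_range_periodic[of _ "2 * pi"])
  then obtain C1 C2 where "\<And>t. norm (v t) \<le> C1" "\<And>t. norm (v' t) \<le> C2"
    unfolding bounded_iff by auto
  then obtain C where C: "C > 0" "\<And>t. norm (v t) \<le> C" "\<And>t. norm (v' t) \<le> C"
    by (metis less_max_iff_disj max.coboundedI1 max.coboundedI2 zero_less_one)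
  have W_upper: "\<bar>W t\<bar> \<le> C * (2 + ((norm (x t))\<^sup>2 + (norm (x' t))\<^sup>2))" for t
  proof -
    have le: "a \<le> 1 + a\<^sup>2" for a :: real
      using zero_le_power2[of "a - 1/2"] by (simp add: power2_eq_square algebra_simps)
    have "\<bar>W t\<bar> \<le> norm (x' t) * norm (v t) + norm (x t) * norm (v' t)"
      unfolding W_def
      using Cauchy_Schwarz_ineq2[of "x' t" "v t"] Cauchy_Schwarz_ineq2[of "x t" "v' t"] by linarith
    also have "\<dots> \<le> (1 + (norm (x' t))\<^sup>2) * C + (1 + (norm (x t))\<^sup>2) * C"
      using C by (intro add_mono mult_mono le) auto
    finally show ?thesis by (simp add: algebra_simps)
  qed
  have lower: "(- b / C - 2) + (c / C) * norm t \<le> (norm (x t))\<^sup>2 + (norm (x' t))\<^sup>2" for t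
  proof -
    have "(c * \<bar>t\<bar> - b) / C \<le> 2 + ((norm (x t))\<^sup>2 + (norm (x' t))\<^sup>2)"
      using order_trans[OF W_lower W_upper, of t] C(1) by (simp add: pos_divide_le_eq mult.commute)
    then show ?thesis by (simp add: diff_divide_distrib)
  qed
  have "filterlim (\<lambda>t::real. (- b / C - 2) + (c / C) * norm t) at_top at_infinity"
    using \<open>c > 0\<close> C(1)
    by (intro filterlim_tendsto_add_at_top[OF tendsto_const] filterlim_tendsto_pos_mult_at_top[OF tendsto_const]
        filterlim_norm_at_top) auto
  then show ?thesis
    by (rule filterlim_at_top_mono) (rule always_eventually, intro allI lower)
qed

end
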